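(* Let $f\colon\mathbb{R}^n\to\mathbb{R}$ be convex and twice continuously differentiable, let $X^\ast\subset\mathbb{R}^n$ be the set of global minimizers of $f$, and let $x^\ast\in X^\ast$. Let $p\in(1,3]$ and let $L>0$, $c_1\ge L$, $c_2\in(0,1)$, $q\ge0$ be constants. Assume: (A1) for all $x,y\in\mathbb{R}^n$, $\|\nabla f(x)-\nabla f(y)-\nabla^2 f(y)(x-y)\|\le L\|x-y\|^2$ and $|f(x)-f(y)-\langle\nabla f(y),x-y\rangle-\frac12\langle\nabla^2 f(y)(x-y),x-y\rangle|\le\frac{L}{3}\|x-y\|^3$; (A7) there exist $r_1>0$ and $m_1>0$ such that $\mathrm{dist}(x,X^\ast)\le m_1\|\nabla f(x)\|$ for every $x\in B(x^\ast,r_1)$. Then there exists $r>0$ such that the following holds for every $x_0\in B(x^\ast,r)$. Let $\{x_k\}_{k\ge0}$ be any infinite sequence generated from $x_0$ by the generalized regularized Newton method (GRNM, see context) with exponent $p$ and parameters $$\mu_k=c_1^{\frac{p-1}{2}}\|\nabla f(x_k)\|^{\frac{3-p}{2}},\qquad \rho_k=\min\left\{\tfrac{q}{\sqrt n}\|\nabla f(x_k)\|,\;c_2\|\nabla f(x_k)\|^{\frac{p+1}{2}}\right\}\qquad(k\ge0),$$ with $\nabla f(x_k)\ne0$ for all $k\ge0$. Then $\{x_k\}$ converges superlinearly to some $\bar x\in X^\ast$. Moreover, if $p=3$, then $\{x_k\}$ converges to $\bar x\in X^\ast$ quadratically.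
   Context: $\|\cdot\|$ is the Euclidean norm on $\mathbb{R}^n$, $\|\cdot\|_1$ is the $L^1$ norm, $\langle\cdot,\cdot\rangle$ is the standard inner product; $B(\eta,r)=\{x:\|x-\eta\|\le r\}$ is the closed ball; $\mathrm{dist}(x,X^\ast)=\inf_{y\in X^\ast}\|x-y\|$. GRNM: given a fixed exponent $p\in(1,3]$, a starting point $x_0$ and parameters $\mu_k>0$, $\rho_k\ge0$, at each iteration $k=0,1,2,\dots$ let $d_k$ be the (unique) global minimizer over $d\in\mathbb{R}^n$ of $$\varphi_k(d)=\langle\nabla f(x_k),d\rangle+\tfrac12\langle\nabla^2 f(x_k)d,d\rangle+\tfrac{\mu_k}{p}\|d\|^p+\rho_k\|d\|_1,$$ and set $x_{k+1}:=x_k+d_k$. Superlinear convergence to $\bar x$ means $x_k\to\bar x$ and $\|x_{k+1}-\bar x\|/\|x_k-\bar x\|\to0$; quadratic convergence means $x_k\to\bar x$ and there is $C>0$ with $\|x_{k+1}-\bar x\|\le C\|x_k-\bar x\|^2$ for all sufficiently large $k$. *)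

theory Defs
  imports "HOL-Analysis.Analysis"
begin

definition norm_L1 :: "real ^ 'n \<Rightarrow> real" where
  "norm_L1 d = (\<Sum>i\<in>UNIV. \<bar>d $ i\<bar>)"

definition global_minimizers :: "('a \<Rightarrow> real) \<Rightarrow> 'a set" where
  "global_minimizers f = {x. \<forall>y. f x \<le> f y}"

text \<open>The model function: \<open>g\<close>, \<open>H\<close> stand for the gradient and Hessian at the current iterate;
  the constant term \<open>f(x)\<close> is omitted. Note \<open>norm d powr p = 0\<close> for \<open>d = 0\<close>, as intended.\<close>

definition grnm_model ::
  "real \<Rightarrow> real \<Rightarrow> real \<Rightarrow> real ^ 'n \<Rightarrow> real ^ 'n ^ 'n \<Rightarrow> real ^ 'n \<Rightarrow> real" where
  "grnm_model p \<mu> \<rho> g H d =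
     g \<bullet> d + 1/2 * ((H *v d) \<bullet> d) + \<mu> / p * norm d powr p + \<rho> * norm_L1 d"

text \<open>Only minimality of the step is required: if \<open>p > 1\<close>, \<open>\<mu> k > 0\<close>, \<open>\<rho> k \<ge> 0\<close> and the Hessian is
  positive semidefinite, then the model is strictly convex and its minimizer is unique.\<close>

definition grnm_sequence ::
  "(real ^ 'n \<Rightarrow> real ^ 'n) \<Rightarrow> (real ^ 'n \<Rightarrow> real ^ 'n ^ 'n) \<Rightarrow> real \<Rightarrow>
   (nat \<Rightarrow> real) \<Rightarrow> (nat \<Rightarrow> real) \<Rightarrow> real ^ 'n \<Rightarrow> (nat \<Rightarrow> real ^ 'n) \<Rightarrow> bool" where
  "grnm_sequence grad hess p \<mu> \<rho> x0 x \<longleftrightarrow>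
     x 0 = x0 \<and>
     (\<forall>k. \<exists>d. is_arg_min (grnm_model p (\<mu> k) (\<rho> k) (grad (x k)) (hess (x k))) (\<lambda>_. True) d
            \<and> x (Suc k) = x k + d)"

text \<open>Division by zero yields zero, so the quotient below has its usual meaning only when
  \<open>x k \<noteq> l\<close>. This holds whenever \<open>l\<close> is a critical point and the gradient does not vanish at any
  \<open>x k\<close>.\<close>

definition converges_superlinearly :: "(nat \<Rightarrow> 'a::real_normed_vector) \<Rightarrow> 'a \<Rightarrow> bool" where
  "converges_superlinearly x l \<longleftrightarrow>
     x \<longlonglongrightarrow> l \<and> (\<lambda>k. norm (x (Suc k) - l) / norm (x k - l)) \<longlonglongrightarrow> 0"

definition converges_quadratically :: "(nat \<Rightarrow> 'a::real_normed_vector) \<Rightarrow> 'a \<Rightarrow> bool" where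
  "converges_quadratically x l \<longleftrightarrow>
     x \<longlonglongrightarrow> l \<and>
     (\<exists>C>0. \<forall>\<^sub>F k in sequentially. norm (x (Suc k) - l) \<le> C * (norm (x k - l))\<^sup>2)"

end

theory Submission
  imports Defs
begin

text \<open>
  Write \<open>\<delta>\<close> for the distance of the current iterate \<open>x\<close> to the solution set, \<open>g\<close>, \<open>H\<close> for gradient and
  Hessian at \<open>x\<close>, and \<open>e\<close> for the vector from \<open>x\<close> to a nearest solution, so that \<open>norm e = \<delta>\<close>. By the
  error bound and the local boundedness of the Hessian, \<open>norm g\<close> is comparable to \<open>\<delta>\<close>; hence \<open>\<mu>\<close> is
  comparable to \<open>\<delta> powr ((3 - p) / 2)\<close> and \<open>\<rho>\<close> is at most of order \<open>\<delta> powr ((p + 1) / 2)\<close>. The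
  gradient vanishes at the solution, so \<open>norm (g + H *v e)\<close> is of order \<open>\<delta>\<^sup>2\<close>: the vector \<open>e\<close> solves the
  Newton equation up to second order.

  Two facts about the step \<open>d\<close> follow. Since the model at \<open>d\<close> is at most its value at \<open>e\<close>, and since \<open>H\<close>
  is symmetric and positive semidefinite, \<open>norm d\<close> is at most of order \<open>\<delta>\<close>
  (\<open>grnm_model_minimizer_norm_le\<close>, \<open>regularized_step_le\<close>). Stationarity of the model at \<open>d\<close> makes the
  Newton residual \<open>g + H *v d\<close> as small as the derivative of the regularization
  (\<open>grnm_model_minimizer_residual_le\<close>), which has order
  \<open>(3 - p) / 2 + (p - 1) = (p + 1) / 2\<close> in \<open>\<delta>\<close>. The gradient at \<open>x + d\<close> differs from this residual by
  order \<open>\<delta>\<^sup>2\<close>, and \<open>(p + 1) / 2 \<le> 2\<close>. By the error bound again, the distance to the solution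
  set drops from \<open>\<delta>\<close> to order \<open>\<delta> powr ((p + 1) / 2)\<close>.

  The exponent exceeds 1 and the steps are bounded by multiples of the distances, so near the solution
  the iterates cannot escape and their remaining path is no longer than a multiple of the current
  distance (\<open>local_convergence\<close>). Thus they converge to a single solution, with order \<open>(p + 1) / 2\<close>;
  this is superlinear, and quadratic for \<open>p = 3\<close>.
\<close>

section \<open>Symmetry and positivity of second derivatives\<close>

text \<open>
  The second difference of \<open>f\<close> over the parallelogram spanned by \<open>t *\<^sub>R u\<close> and \<open>t *\<^sub>R v\<close> is symmetric
  in \<open>u\<close> and \<open>v\<close>. By the mean value theorem it equals \<open>t\<^sup>2 * (D u \<bullet> v)\<close> up to \<open>o(t\<^sup>2)\<close>. The step bounds
  need this symmetry, because the gradient of \<open>d \<mapsto> 1/2 * (D d \<bullet> d)\<close> is \<open>D d\<close> only for symmetric \<open>D\<close>.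
\<close>

lemma second_derivative_symmetric:
  fixes f :: "'a::real_inner \<Rightarrow> real"
  assumes grad: "\<And>y. GDERIV f y :> grad y"
    and D: "(grad has_derivative D) (at x)"
  shows "D u \<bullet> v = D v \<bullet> u"
proof -
  interpret D: bounded_linear D by (rule has_derivative_bounded_linear[OF D])
  define S where "S u v t = f (x + t *\<^sub>R u + t *\<^sub>R v) - f (x + t *\<^sub>R u) - f (x + t *\<^sub>R v) + f x"
    for u v t
  have approx: "\<bar>S u v t - t\<^sup>2 * (D u \<bullet> v)\<bar> \<le> 2 * e * t\<^sup>2 * (norm u + norm v)\<^sup>2"
    if "e > 0" "t > 0" "t * (norm u + norm v) < r"
      and r: "\<And>y. norm (y - x) < r \<Longrightarrow> norm (grad y - grad x - D (y - x)) \<le> e * norm (y - x)"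
    for e t r u v
  proof -
    \<comment> \<open>The increment of \<open>\<phi>\<close> over the unit interval is the second difference.\<close>
    define \<phi> where "\<phi> s = f (x + t *\<^sub>R u + (s * t) *\<^sub>R v) - f (x + (s * t) *\<^sub>R v)" for s
    have "(\<phi> has_real_derivative
            t * ((grad (x + t *\<^sub>R u + (s * t) *\<^sub>R v) - grad (x + (s * t) *\<^sub>R v)) \<bullet> v)) (at s)" for s
    proof -
      have "((\<lambda>s. f (z + (s * t) *\<^sub>R v)) has_derivative (\<lambda>h. ((h * t) *\<^sub>R v) \<bullet> grad (z + (s * t) *\<^sub>R v))) (at s)" for z
        by (rule has_derivative_compose[where g = f, OF _ grad[unfolded gderiv_def]])
          (auto intro!: derivative_eq_intros)
      from has_derivative_diff[OF this[of "x + t *\<^sub>R u"] this[of x]]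
      show ?thesis
        unfolding \<phi>_def has_field_derivative_def
        by (rule has_derivative_eq_rhs) (auto simp: fun_eq_iff algebra_simps inner_commute)
    qed
    then obtain s where s: "0 < s" "s < 1"
      and "\<phi> 1 - \<phi> 0 = (1 - 0) * (t * ((grad (x + t *\<^sub>R u + (s * t) *\<^sub>R v) - grad (x + (s * t) *\<^sub>R v)) \<bullet> v))"
      using MVT2[of 0 1 \<phi> "\<lambda>s. t * ((grad (x + t *\<^sub>R u + (s * t) *\<^sub>R v) - grad (x + (s * t) *\<^sub>R v)) \<bullet> v)"]
      by (auto simp del: of_nat_Suc)
    moreover have "S u v t = \<phi> 1 - \<phi> 0" by (simp add: S_def \<phi>_def)
    ultimately have S: "S u v t = t * ((grad (x + t *\<^sub>R u + (s * t) *\<^sub>R v) - grad (x + (s * t) *\<^sub>R v)) \<bullet> v)"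
      by simp
    let ?R = "\<lambda>h. grad (x + h) - grad x - D h"
    have R: "norm (?R h) \<le> e * (t * (norm u + norm v))" if h: "norm h \<le> t * (norm u + norm v)" for h
    proof -
      have "norm (?R h) \<le> e * norm h" using r[of "x + h"] h that(1) \<open>t * _ < r\<close> by auto
      also have "\<dots> \<le> e * (t * (norm u + norm v))" using h \<open>e > 0\<close> by simp
      finally show ?thesis .
    qed
    have st: "s * (t * norm v) \<le> t * norm v"
      using s \<open>t > 0\<close> mult_right_mono[of s 1 "t * norm v"] by auto
    have n2: "norm ((s * t) *\<^sub>R v) \<le> t * (norm u + norm v)"
      using st s \<open>t > 0\<close> by (auto simp: algebra_simps intro: order_trans add_increasing)
    have n1: "norm (t *\<^sub>R u + (s * t) *\<^sub>R v) \<le> t * (norm u + norm v)"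
    proof -
      have "norm (t *\<^sub>R u + (s * t) *\<^sub>R v) \<le> t * norm u + s * (t * norm v)"
        using s \<open>t > 0\<close> norm_triangle_ineq[of "t *\<^sub>R u" "(s * t) *\<^sub>R v"] by (simp add: mult.assoc)
      also have "\<dots> \<le> t * (norm u + norm v)" unfolding distrib_left using st by (rule add_left_mono)
      finally show ?thesis .
    qed
    have eq: "S u v t - t\<^sup>2 * (D u \<bullet> v) = t * ((?R (t *\<^sub>R u + (s * t) *\<^sub>R v) - ?R ((s * t) *\<^sub>R v)) \<bullet> v)"
      unfolding S by (simp add: D.add D.scaleR algebra_simps power2_eq_square add.assoc)
    have "\<bar>(?R (t *\<^sub>R u + (s * t) *\<^sub>R v) - ?R ((s * t) *\<^sub>R v)) \<bullet> v\<bar>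
        \<le> norm (?R (t *\<^sub>R u + (s * t) *\<^sub>R v) - ?R ((s * t) *\<^sub>R v)) * norm v"
      by (rule Cauchy_Schwarz_ineq2)
    also have "\<dots> \<le> (2 * (e * (t * (norm u + norm v)))) * (norm u + norm v)"
      using R[OF n1] R[OF n2] \<open>e > 0\<close> \<open>t > 0\<close>
        norm_triangle_ineq4[of "?R (t *\<^sub>R u + (s * t) *\<^sub>R v)" "?R ((s * t) *\<^sub>R v)"]
      by (intro mult_mono) auto
    finally have "t * \<bar>(?R (t *\<^sub>R u + (s * t) *\<^sub>R v) - ?R ((s * t) *\<^sub>R v)) \<bullet> v\<bar>
        \<le> t * ((2 * (e * (t * (norm u + norm v)))) * (norm u + norm v))"
      using \<open>t > 0\<close> by simp
    then show ?thesis
      unfolding eq abs_mult using \<open>t > 0\<close> by (simp add: power2_eq_square algebra_simps)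
  qed
  have "\<bar>D u \<bullet> v - D v \<bullet> u\<bar> \<le> e * (4 * (norm u + norm v)\<^sup>2)" if "e > 0" for e
  proof -
    obtain r where r: "r > 0"
      "\<And>y. norm (y - x) < r \<Longrightarrow> norm (grad y - grad x - D (y - x)) \<le> e * norm (y - x)"
      using D \<open>e > 0\<close> unfolding has_derivative_at_alt by metis
    define t where "t = r / (norm u + norm v + 1)"
    have "t > 0" using r unfolding t_def by (intro divide_pos_pos) (auto intro: add_nonneg_pos)
    have "norm u + norm v + 1 \<noteq> 0" using norm_ge_zero[of u] norm_ge_zero[of v] by linarith
    then have "t * (norm u + norm v + 1) = r" by (simp add: t_def)
    then have lt: "t * (norm u + norm v) < r" using \<open>t > 0\<close> by (simp add: distrib_left)
    have "S u v t = S v u t" by (simp add: S_def algebra_simps)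
    with approx[OF \<open>e > 0\<close> \<open>t > 0\<close> lt r(2)] approx[of e t v u r] \<open>e > 0\<close> \<open>t > 0\<close> lt r(2)
    have "\<bar>t\<^sup>2 * (D u \<bullet> v) - t\<^sup>2 * (D v \<bullet> u)\<bar> \<le> 4 * e * t\<^sup>2 * (norm u + norm v)\<^sup>2"
      by (simp add: add.commute)
    moreover have "\<bar>t\<^sup>2 * (D u \<bullet> v) - t\<^sup>2 * (D v \<bullet> u)\<bar> = t\<^sup>2 * \<bar>D u \<bullet> v - D v \<bullet> u\<bar>"
      by (simp add: abs_mult flip: right_diff_distrib)
    ultimately have "t\<^sup>2 * \<bar>D u \<bullet> v - D v \<bullet> u\<bar> \<le> t\<^sup>2 * (e * (4 * (norm u + norm v)\<^sup>2))"
      by (simp add: mult_ac)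
    then show ?thesis using \<open>t > 0\<close> by simp
  qed
  then have "\<bar>D u \<bullet> v - D v \<bullet> u\<bar> \<le> 0"
  proof (cases "norm u + norm v = 0")
    case True then show ?thesis by (simp add: add_nonneg_eq_0_iff)
  next
    case False
    then have pos: "4 * (norm u + norm v)\<^sup>2 > 0" by simp
    show ?thesis
    proof (rule field_le_epsilon)
      fix e :: real assume "e > 0"
      with \<open>\<And>e. e > 0 \<Longrightarrow> _\<close>[of "e / (4 * (norm u + norm v)\<^sup>2)"] pos False
      show "\<bar>D u \<bullet> v - D v \<bullet> u\<bar> \<le> 0 + e" by (auto simp: field_simps)
    qed
  qed
  then show ?thesis by simp
qed

text \<open>
  Convexity makes \<open>f (x + t *\<^sub>R h) + f (x - t *\<^sub>R h) - 2 * f x\<close> nonnegative. The first-order terms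
  cancel, leaving \<open>t\<^sup>2 * (D h \<bullet> h)\<close> up to a cubic error.
\<close>

lemma convex_second_order_nonneg:
  fixes f :: "'a::real_inner \<Rightarrow> real"
  assumes convex: "convex_on UNIV f" and D: "linear D"
    and approx: "\<And>h. \<bar>f (x + h) - f x - g \<bullet> h - 1/2 * (D h \<bullet> h)\<bar> \<le> K * norm h ^ 3"
  shows "0 \<le> D h \<bullet> h"
proof -
  have "- (D h \<bullet> h) \<le> t * (2 * K * norm h ^ 3)" if "t > 0" for t
  proof -
    have "f x \<le> 1/2 * f (x + t *\<^sub>R h) + 1/2 * f (x + - t *\<^sub>R h)"
    proof -
      have "x = (1/2) *\<^sub>R (x + t *\<^sub>R h) + (1/2) *\<^sub>R (x + - t *\<^sub>R h)"
        by (simp add: algebra_simps flip: scaleR_add_left)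
      then show ?thesis
        using convex_onD[OF convex, of "1/2" "x + t *\<^sub>R h" "x + - t *\<^sub>R h"] by simp
    qed
    moreover have "D (t *\<^sub>R h) \<bullet> (t *\<^sub>R h) = t\<^sup>2 * (D h \<bullet> h)"
      "D (- t *\<^sub>R h) \<bullet> (- t *\<^sub>R h) = t\<^sup>2 * (D h \<bullet> h)"
      by (simp_all only: linear_scale[OF D]) (simp_all add: power2_eq_square)
    moreover have "norm (t *\<^sub>R h) ^ 3 = t^3 * norm h ^ 3" "norm (- t *\<^sub>R h) ^ 3 = t^3 * norm h ^ 3"
      using \<open>t > 0\<close> by (simp_all add: power_mult_distrib)
    ultimately have "- (t\<^sup>2 * (D h \<bullet> h)) \<le> 2 * (K * (t^3 * norm h ^ 3))"
      using approx[of "t *\<^sub>R h"] approx[of "- t *\<^sub>R h"] by (simp add: abs_le_iff)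
    then have "t\<^sup>2 * (- (D h \<bullet> h)) \<le> t\<^sup>2 * (t * (2 * K * norm h ^ 3))"
      by (simp add: power2_eq_square power3_eq_cube mult_ac)
    then show ?thesis using \<open>t > 0\<close> by (simp only: mult_le_cancel_left_pos zero_less_power)
  qed
  then have ev: "eventually (\<lambda>t. - (D h \<bullet> h) \<le> t * (2 * K * norm h ^ 3)) (at_right 0)"
    by (auto simp: eventually_at_filter)
  have "((\<lambda>t. t * (2 * K * norm h ^ 3)) \<longlongrightarrow> 0 * (2 * K * norm h ^ 3)) (at_right 0)"
    by (intro tendsto_intros)
  from tendsto_lowerbound[OF this ev] show ?thesis by simp
qed

section \<open>Minimizers of the regularized model\<close>

lemma norm_L1_triangle: "norm_L1 (a + b) \<le> norm_L1 a + norm_L1 b"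
  unfolding norm_L1_def by (simp flip: sum.distrib add: sum_mono)

lemma norm_L1_nonneg: "0 \<le> norm_L1 a"
  unfolding norm_L1_def by (simp add: sum_nonneg)

lemma norm_L1_le_norm:
  fixes a :: "real ^ 'n"
  shows "norm_L1 a \<le> sqrt (real CARD('n)) * norm a"
proof -
  have "norm_L1 a = (\<Sum>i\<in>UNIV. \<bar>1\<bar> * \<bar>a $ i\<bar>)" by (simp add: norm_L1_def)
  also have "\<dots> \<le> L2_set (\<lambda>_. 1) (UNIV :: 'n set) * L2_set (\<lambda>i. a $ i) UNIV"
    by (rule L2_set_mult_ineq)
  also have "\<dots> = sqrt (real CARD('n)) * norm a"
    by (simp add: L2_set_def norm_vec_def)
  finally show ?thesis .
qed

text \<open>
  The derivative of \<open>y \<mapsto> y powr p\<close> increases, so its value at the right end bounds the increment. In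
  this form the bound also covers \<open>a = 0\<close>, that is, a zero step.
\<close>

lemma powr_add_le:
  fixes a t p :: real
  assumes "0 \<le> a" "0 < t" "1 \<le> p"
  shows "(a + t) powr p \<le> a powr p + p * t * (a + t) powr (p - 1)"
proof -
  have "(a + t) powr p - a powr p \<le> p * t * (a + t) powr (p - 1)"
  proof (cases "a = 0")
    case True
    have "t powr p = t * t powr (p - 1)" using assms by (simp add: powr_diff)
    also have "\<dots> \<le> p * (t * t powr (p - 1))" using assms mult_right_mono[of 1 p "t * t powr (p - 1)"] by simp
    finally show ?thesis using True by (simp add: mult_ac)
  next
    case False
    have "((\<lambda>x. x powr p) has_real_derivative p * y powr (p - 1)) (at y)" if "a \<le> y" for y
      using that assms False by (auto intro!: derivative_eq_intros simp: powr_diff)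
    from MVT2[of a "a + t" "\<lambda>x. x powr p" "\<lambda>y. p * y powr (p - 1)", OF _ this] assms
    obtain z where z: "a < z" "z < a + t"
      "(a + t) powr p - a powr p = t * (p * z powr (p - 1))" by auto
    moreover have "z powr (p - 1) \<le> (a + t) powr (p - 1)"
      using z assms by (intro powr_mono2) auto
    ultimately show ?thesis using assms by (simp add: mult_ac mult_left_mono)
  qed
  then show ?thesis by simp
qed

text \<open>
  The smooth quadratic part of the model, expanded around \<open>e\<close>, has the gradient \<open>g + H *v e\<close> and a
  nonnegative second-order term. Comparing the model at \<open>d\<close> and at \<open>e\<close> therefore bounds the
  regularization at \<open>d\<close> by the one at \<open>e\<close> and a term that is small when \<open>e\<close> almost solves the Newton
  equation.
\<close>

lemma grnm_model_minimizer_norm_le: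
  fixes g d e :: "real ^ 'n" and H :: "real ^ 'n ^ 'n"
  assumes min: "is_arg_min (grnm_model p \<mu> \<rho> g H) (\<lambda>_. True) d"
    and sym: "\<And>u v. (H *v u) \<bullet> v = (H *v v) \<bullet> u"
    and psd: "\<And>u. 0 \<le> (H *v u) \<bullet> u"
    and "0 \<le> \<rho>"
  shows "\<mu> / p * norm d powr p \<le> \<mu> / p * norm e powr p + \<rho> * sqrt (real CARD('n)) * norm e
           + norm (g + H *v e) * (norm d + norm e)"
proof -
  have "grnm_model p \<mu> \<rho> g H d \<le> grnm_model p \<mu> \<rho> g H e"
    using min by (simp add: is_arg_min_linorder)
  moreover have "g \<bullet> d + 1/2 * ((H *v d) \<bullet> d) - (g \<bullet> e + 1/2 * ((H *v e) \<bullet> e))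
      = (g + H *v e) \<bullet> (d - e) + 1/2 * ((H *v (d - e)) \<bullet> (d - e))"
    using sym[of d e] by (simp add: algebra_simps matrix_vector_mult_diff_distrib inner_commute)
  moreover have "- ((g + H *v e) \<bullet> (d - e)) \<le> norm (g + H *v e) * (norm d + norm e)"
  proof -
    have "- ((g + H *v e) \<bullet> (d - e)) \<le> norm (g + H *v e) * norm (d - e)"
      using Cauchy_Schwarz_ineq2[of "g + H *v e" "d - e"] by simp
    also have "\<dots> \<le> norm (g + H *v e) * (norm d + norm e)"
      by (intro mult_left_mono norm_triangle_ineq4) auto
    finally show ?thesis .
  qed
  moreover have "0 \<le> \<rho> * norm_L1 d" using \<open>0 \<le> \<rho>\<close> norm_L1_nonneg[of d] by simp
  moreover have "\<rho> * norm_L1 e \<le> \<rho> * (sqrt (real CARD('n)) * norm e)"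
    using \<open>0 \<le> \<rho>\<close> norm_L1_le_norm by (rule mult_left_mono[rotated])
  ultimately show ?thesis
    using psd[of "d - e"] unfolding grnm_model_def by (simp add: algebra_simps)
qed

text \<open>
  This is the first-order condition, without subgradients: moving from \<open>d\<close> by \<open>t\<close> along a unit vector
  does not decrease the model, and the regularization terms grow at most at the rates
  \<open>\<mu> * norm d powr (p - 1)\<close> and \<open>\<rho> * sqrt n\<close> as \<open>t\<close> tends to 0. The direction opposite to the residual
  gives the claim.
\<close>

lemma grnm_model_minimizer_residual_le:
  fixes g d :: "real ^ 'n" and H :: "real ^ 'n ^ 'n"
  assumes min: "is_arg_min (grnm_model p \<mu> \<rho> g H) (\<lambda>_. True) d"
    and sym: "\<And>u v. (H *v u) \<bullet> v = (H *v v) \<bullet> u"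
    and "1 < p" "0 \<le> \<mu>" "0 \<le> \<rho>"
  shows "norm (g + H *v d) \<le> \<mu> * norm d powr (p - 1) + \<rho> * sqrt (real CARD('n))"
proof -
  let ?n = "sqrt (real CARD('n))"
  have dir: "- ((g + H *v d) \<bullet> u) \<le> \<mu> * norm d powr (p - 1) + \<rho> * ?n" if u: "norm u = 1" for u
  proof -
    have "- ((g + H *v d) \<bullet> u) \<le> t / 2 * ((H *v u) \<bullet> u) + \<mu> * (norm d + t) powr (p - 1) + \<rho> * ?n"
      if "t > 0" for t
    proof -
      have "grnm_model p \<mu> \<rho> g H d \<le> grnm_model p \<mu> \<rho> g H (d + t *\<^sub>R u)"
        using min by (simp add: is_arg_min_linorder)
      moreover have "g \<bullet> (d + t *\<^sub>R u) + 1/2 * ((H *v (d + t *\<^sub>R u)) \<bullet> (d + t *\<^sub>R u))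
          - (g \<bullet> d + 1/2 * ((H *v d) \<bullet> d)) = t * ((g + H *v d) \<bullet> u) + t\<^sup>2 / 2 * ((H *v u) \<bullet> u)"
        using sym[of d u]
        by (simp add: algebra_simps matrix_vector_right_distrib matrix_vector_mult_scaleR power2_eq_square)
      moreover have "\<mu> / p * norm (d + t *\<^sub>R u) powr p \<le> \<mu> / p * norm d powr p + \<mu> * t * (norm d + t) powr (p - 1)"
      proof -
        have "norm (d + t *\<^sub>R u) powr p \<le> (norm d + t) powr p"
          using norm_triangle_ineq[of d "t *\<^sub>R u"] u \<open>1 < p\<close> \<open>t > 0\<close> by (intro powr_mono2) auto
        also have "\<dots> \<le> norm d powr p + p * t * (norm d + t) powr (p - 1)"
          using \<open>1 < p\<close> \<open>t > 0\<close> by (intro powr_add_le) auto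
        finally have "\<mu> / p * norm (d + t *\<^sub>R u) powr p \<le> \<mu> / p * (norm d powr p + p * t * (norm d + t) powr (p - 1))"
          using \<open>1 < p\<close> \<open>0 \<le> \<mu>\<close> by (intro mult_left_mono) auto
        then show ?thesis using \<open>1 < p\<close> by (simp add: field_simps)
      qed
      moreover have "\<rho> * norm_L1 (d + t *\<^sub>R u) \<le> \<rho> * norm_L1 d + \<rho> * (?n * t)"
      proof -
        have "norm_L1 (d + t *\<^sub>R u) \<le> norm_L1 d + ?n * t"
          using norm_L1_triangle[of d "t *\<^sub>R u"] norm_L1_le_norm[of "t *\<^sub>R u"] u \<open>t > 0\<close> by simp
        then show ?thesis using \<open>0 \<le> \<rho>\<close> by (simp add: mult_left_mono flip: distrib_left)
      qed
      ultimately have "0 \<le> t * ((g + H *v d) \<bullet> u) + t\<^sup>2 / 2 * ((H *v u) \<bullet> u)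
          + \<mu> * t * (norm d + t) powr (p - 1) + \<rho> * (?n * t)"
        unfolding grnm_model_def by linarith
      also have "\<dots> = t * ((g + H *v d) \<bullet> u + (t / 2 * ((H *v u) \<bullet> u) + \<mu> * (norm d + t) powr (p - 1) + \<rho> * ?n))"
        by (simp add: algebra_simps power2_eq_square)
      finally show ?thesis using \<open>t > 0\<close> by (simp add: zero_le_mult_iff)
    qed
    then have ev: "eventually (\<lambda>t. - ((g + H *v d) \<bullet> u) \<le>
        t / 2 * ((H *v u) \<bullet> u) + \<mu> * (norm d + t) powr (p - 1) + \<rho> * ?n) (at_right 0)"
      by (auto simp: eventually_at_filter)
    have pos: "eventually (\<lambda>t. 0 \<le> norm d + t) (at_right 0)"
      by (auto simp: eventually_at_filter)
    have "((\<lambda>t. t / 2 * ((H *v u) \<bullet> u) + \<mu> * (norm d + t) powr (p - 1) + \<rho> * ?n)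
        \<longlongrightarrow> 0 / 2 * ((H *v u) \<bullet> u) + \<mu> * (norm d + 0) powr (p - 1) + \<rho> * ?n) (at_right 0)"
      using \<open>1 < p\<close> by (intro tendsto_add tendsto_mult tendsto_divide tendsto_const tendsto_ident_at
          tendsto_powr2 pos) auto
    from tendsto_lowerbound[OF this ev] show ?thesis by simp
  qed
  show ?thesis
  proof (cases "g + H *v d = 0")
    case True
    then show ?thesis using assms by simp
  next
    case False
    then have "(g + H *v d) \<bullet> sgn (g + H *v d) = norm (g + H *v d)"
      by (simp add: sgn_div_norm flip: norm_eq_sqrt_inner power2_norm_eq_inner)
        (simp add: power2_eq_square)
    with dir[of "- sgn (g + H *v d)"] False show ?thesis by (simp add: norm_sgn)
  qed
qed

section \<open>Orders of magnitude in terms of the distance to the solution set\<close>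

text \<open>
  Let \<open>t > \<delta>\<close>. Then the right-hand side of the assumed bound, apart from its first term, is at most of
  order \<open>\<delta> powr ((p + 1) / 2) * t\<close>. Dividing by \<open>\<mu>\<close> turns this into \<open>\<delta> powr (p - 1) * t\<close>, as
  \<open>(p + 1) / 2 - (3 - p) / 2 = p - 1\<close>. So \<open>t powr p\<close> is at most of order \<open>\<delta> powr (p - 1) * t\<close>, and
  \<open>p > 1\<close> lets a factor \<open>t\<close> be cancelled.
\<close>

lemma regularized_step_le:
  fixes A E L p \<delta> \<mu> \<sigma> t :: real
  assumes p: "1 < p" "p \<le> 3" and "A > 0" "E \<ge> 0" "L \<ge> 0"
    and \<delta>: "0 < \<delta>" "\<delta> \<le> 1" and "0 \<le> t"
    and \<mu>: "A * \<delta> powr ((3 - p) / 2) \<le> \<mu>"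
    and \<sigma>: "\<sigma> \<le> E * \<delta> powr ((p + 1) / 2)"
    and bound: "\<mu> / p * t powr p \<le> \<mu> / p * \<delta> powr p + \<sigma> * \<delta> + L * \<delta>\<^sup>2 * (t + \<delta>)"
  shows "t \<le> (1 + p / A * (E + 2 * L)) powr (1 / (p - 1)) * \<delta>"
proof -
  define K where "K = p / A * (E + 2 * L)"
  have K: "K \<ge> 0" using assms unfolding K_def by simp
  show ?thesis
  proof (cases "t \<le> \<delta>")
    case True
    have "1 \<le> (1 + K) powr (1 / (p - 1))" using K p by (intro ge_one_powr_ge_zero) auto
    then have "1 * \<delta> \<le> (1 + K) powr (1 / (p - 1)) * \<delta>" using \<delta> by (intro mult_right_mono) auto
    then show ?thesis using True unfolding K_def by linarith
  next
    case False
    then have t: "t > \<delta>" "t > 0" using \<delta> by auto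
    have mono: "\<delta> powr p \<le> t powr p" using t \<delta> p by (intro powr_mono2) auto
    have s2: "\<delta>\<^sup>2 \<le> \<delta> powr ((p + 1) / 2)"
      using powr_mono'[of "(p + 1) / 2" 2 \<delta>] p \<delta> by simp
    have "A * \<delta> powr ((3 - p) / 2) / p * (t powr p - \<delta> powr p) \<le> \<mu> / p * (t powr p - \<delta> powr p)"
      using \<mu> p mono by (intro mult_right_mono divide_right_mono) auto
    also have "\<dots> \<le> \<sigma> * \<delta> + L * \<delta>\<^sup>2 * (t + \<delta>)" using bound by (simp add: algebra_simps)
    also have "\<dots> \<le> E * \<delta> powr ((p + 1) / 2) * t + L * \<delta> powr ((p + 1) / 2) * (2 * t)"
    proof (rule add_mono)
      have "\<sigma> * \<delta> \<le> E * \<delta> powr ((p + 1) / 2) * \<delta>" using \<sigma> \<delta> by simp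
      also have "\<dots> \<le> E * \<delta> powr ((p + 1) / 2) * t"
        using t \<open>E \<ge> 0\<close> by (intro mult_left_mono) auto
      finally show "\<sigma> * \<delta> \<le> E * \<delta> powr ((p + 1) / 2) * t" .
    qed (use s2 t \<delta> \<open>L \<ge> 0\<close> in \<open>auto intro!: mult_mono\<close>)
    also have "\<dots> = (E + 2 * L) * \<delta> powr ((p + 1) / 2) * t" by (simp add: algebra_simps)
    also have "\<delta> powr ((p + 1) / 2) = \<delta> powr ((3 - p) / 2) * \<delta> powr (p - 1)"
      by (simp add: powr_add[symmetric] field_simps)
    finally have "\<delta> powr ((3 - p) / 2) * (A / p * (t powr p - \<delta> powr p))
        \<le> \<delta> powr ((3 - p) / 2) * ((E + 2 * L) * \<delta> powr (p - 1) * t)"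
      by (simp add: mult_ac)
    then have "A / p * (t powr p - \<delta> powr p) \<le> (E + 2 * L) * \<delta> powr (p - 1) * t"
      by (rule mult_left_le_imp_le) (use \<delta> in simp)
    then have "t powr p \<le> \<delta> powr p + K * \<delta> powr (p - 1) * t"
      unfolding K_def using \<open>A > 0\<close> p by (simp add: field_simps)
    also have "\<delta> powr p = \<delta> powr (p - 1) * \<delta>" using \<delta> by (simp add: powr_diff)
    also have "\<dots> \<le> \<delta> powr (p - 1) * t" using t by (intro mult_left_mono) auto
    finally have "t powr p \<le> ((1 + K) * \<delta> powr (p - 1)) * t" by (simp add: algebra_simps)
    also have "t powr p = t powr (p - 1) * t" using t by (simp add: powr_diff)
    finally have "t powr (p - 1) \<le> (1 + K) * \<delta> powr (p - 1)" using t by simp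
    then have "(t powr (p - 1)) powr (1 / (p - 1)) \<le> ((1 + K) * \<delta> powr (p - 1)) powr (1 / (p - 1))"
      using p by (intro powr_mono2) auto
    then show ?thesis using p t \<delta> K by (simp add: powr_powr powr_mult K_def)
  qed
qed

text \<open>
  The constant depends only on the data of the problem and not on the iterate; this uniformity is what
  the convergence argument needs.
\<close>

lemma grnm_step_estimates:
  fixes p c c2 m M L :: real
  assumes p: "1 < p" "p \<le> 3" and "c > 0" "c2 \<ge> 0" "m > 0" "M \<ge> 0" "L \<ge> 0"
  obtains C where "C > 0"
    and "\<And>(g :: real ^ 'n) H e d \<rho>.
      \<lbrakk>is_arg_min (grnm_model p (c powr ((p - 1) / 2) * norm g powr ((3 - p) / 2)) \<rho> g H) (\<lambda>_. True) d;
       0 \<le> \<rho>; \<rho> \<le> c2 * norm g powr ((p + 1) / 2);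
       \<And>u v. (H *v u) \<bullet> v = (H *v v) \<bullet> u; \<And>u. 0 \<le> (H *v u) \<bullet> u;
       e \<noteq> 0; norm e \<le> 1; norm e \<le> m * norm g; norm g \<le> M * norm e;
       norm (g + H *v e) \<le> L * (norm e)\<^sup>2\<rbrakk>
      \<Longrightarrow> norm d \<le> C * norm e \<and> norm (g + H *v d) \<le> C * norm e powr ((p + 1) / 2)"
proof -
  let ?n = "sqrt (real CARD('n))"
  define A where "A = c powr ((p - 1) / 2) * (1 / m) powr ((3 - p) / 2)"
  define B where "B = c powr ((p - 1) / 2) * M powr ((3 - p) / 2)"
  define E where "E = c2 * M powr ((p + 1) / 2) * ?n"
  define C1 where "C1 = (1 + p / A * (E + 2 * L)) powr (1 / (p - 1))"
  define C2 where "C2 = B * C1 powr (p - 1) + E"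
  have nn: "A > 0" "B \<ge> 0" "E \<ge> 0" using assms by (auto simp: A_def B_def E_def)
  then have "0 \<le> p / A * (E + 2 * L)" using p \<open>L \<ge> 0\<close> by simp
  then have C1: "C1 > 0" by (auto simp: C1_def)
  have step: "norm d \<le> C1 * norm e \<and> norm (g + H *v d) \<le> C2 * norm e powr ((p + 1) / 2)"
    if min: "is_arg_min (grnm_model p (c powr ((p - 1) / 2) * norm g powr ((3 - p) / 2)) \<rho> g H) (\<lambda>_. True) d"
      and \<rho>: "0 \<le> \<rho>" "\<rho> \<le> c2 * norm g powr ((p + 1) / 2)"
      and sym: "\<And>u v. (H *v u) \<bullet> v = (H *v v) \<bullet> u" and psd: "\<And>u. 0 \<le> (H *v u) \<bullet> u"
      and e: "e \<noteq> 0" "norm e \<le> 1"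
      and g: "norm e \<le> m * norm g" "norm g \<le> M * norm e"
      and ge: "norm (g + H *v e) \<le> L * (norm e)\<^sup>2"
    for g :: "real ^ 'n" and H e d \<rho>
  proof -
    let ?\<delta> = "norm e"
    define \<mu> where "\<mu> = c powr ((p - 1) / 2) * norm g powr ((3 - p) / 2)"
    have "(1 / m * ?\<delta>) powr ((3 - p) / 2) \<le> norm g powr ((3 - p) / 2)"
      using g(1) p \<open>m > 0\<close> by (intro powr_mono2) (auto simp: field_simps)
    then have \<mu>_ge: "A * ?\<delta> powr ((3 - p) / 2) \<le> \<mu>"
      using \<open>m > 0\<close> unfolding A_def \<mu>_def powr_mult mult.assoc by (intro mult_left_mono) auto
    have "norm g powr ((3 - p) / 2) \<le> (M * ?\<delta>) powr ((3 - p) / 2)"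
      using g(2) p by (intro powr_mono2) auto
    then have \<mu>_le: "\<mu> \<le> B * ?\<delta> powr ((3 - p) / 2)"
      using \<open>M \<ge> 0\<close> unfolding B_def \<mu>_def powr_mult mult.assoc by (intro mult_left_mono) auto
    have "norm g powr ((p + 1) / 2) \<le> (M * ?\<delta>) powr ((p + 1) / 2)"
      using g(2) p by (intro powr_mono2) auto
    then have "\<rho> \<le> c2 * (M powr ((p + 1) / 2) * ?\<delta> powr ((p + 1) / 2))"
      using \<rho>(2) \<open>c2 \<ge> 0\<close> unfolding powr_mult by (meson mult_left_mono order_trans)
    then have "\<rho> * ?n \<le> c2 * (M powr ((p + 1) / 2) * ?\<delta> powr ((p + 1) / 2)) * ?n"
      by (rule mult_right_mono) simp
    then have \<rho>_le: "\<rho> * ?n \<le> E * ?\<delta> powr ((p + 1) / 2)"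
      by (simp add: E_def mult_ac)
    have "\<mu> / p * norm d powr p \<le> \<mu> / p * ?\<delta> powr p + \<rho> * ?n * ?\<delta>
           + norm (g + H *v e) * (norm d + ?\<delta>)"
      using min unfolding \<mu>_def[symmetric] by (rule grnm_model_minimizer_norm_le[OF _ sym psd \<rho>(1)])
    also have "norm (g + H *v e) * (norm d + ?\<delta>) \<le> L * ?\<delta>\<^sup>2 * (norm d + ?\<delta>)"
      using ge by (intro mult_right_mono) auto
    finally have d: "norm d \<le> C1 * ?\<delta>"
      unfolding C1_def using p nn \<open>L \<ge> 0\<close> e \<mu>_ge \<rho>_le
      by (intro regularized_step_le[where \<mu> = \<mu> and \<sigma> = "\<rho> * ?n"]) auto
    \<comment> \<open>The exponents \<open>(3 - p) / 2\<close> of \<open>\<mu>\<close> and \<open>p - 1\<close> of the step add up to that of \<open>\<rho>\<close>.\<close>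
    have "\<mu> * norm d powr (p - 1) \<le> B * ?\<delta> powr ((3 - p) / 2) * (C1 * ?\<delta>) powr (p - 1)"
      using d \<mu>_le p nn by (intro mult_mono powr_mono2) auto
    also have "\<dots> = B * C1 powr (p - 1) * (?\<delta> powr ((3 - p) / 2) * ?\<delta> powr (p - 1))"
      using C1 by (simp add: powr_mult)
    also have "?\<delta> powr ((3 - p) / 2) * ?\<delta> powr (p - 1) = ?\<delta> powr ((p + 1) / 2)"
      by (simp add: powr_add[symmetric] field_simps)
    finally have "\<mu> * norm d powr (p - 1) + \<rho> * ?n \<le> C2 * ?\<delta> powr ((p + 1) / 2)"
      using \<rho>_le unfolding C2_def distrib_right by linarith
    moreover have "norm (g + H *v d) \<le> \<mu> * norm d powr (p - 1) + \<rho> * ?n"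
      using min unfolding \<mu>_def[symmetric]
      by (rule grnm_model_minimizer_residual_le[OF _ sym p(1) _ \<rho>(1)]) (simp add: \<mu>_def)
    ultimately show ?thesis using d by simp
  qed
  show ?thesis
  proof (rule that[of "max C1 C2"])
    show "max C1 C2 > 0" using C1 by simp
    fix g :: "real ^ 'n" and H e d \<rho>
    assume "is_arg_min (grnm_model p (c powr ((p - 1) / 2) * norm g powr ((3 - p) / 2)) \<rho> g H) (\<lambda>_. True) d"
      "0 \<le> \<rho>" "\<rho> \<le> c2 * norm g powr ((p + 1) / 2)"
      "\<And>u v. (H *v u) \<bullet> v = (H *v v) \<bullet> u" "\<And>u. 0 \<le> (H *v u) \<bullet> u"
      "e \<noteq> 0" "norm e \<le> 1" "norm e \<le> m * norm g" "norm g \<le> M * norm e"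
      "norm (g + H *v e) \<le> L * (norm e)\<^sup>2"
    from step[OF this]
    show "norm d \<le> max C1 C2 * norm e \<and> norm (g + H *v d) \<le> max C1 C2 * norm e powr ((p + 1) / 2)"
      by (auto elim!: order_trans intro!: mult_right_mono)
  qed
qed

section \<open>Convergence of iterations with an error bound\<close>

text \<open>
  As \<open>s > 1\<close>, in a small ball every step at least halves \<open>infdist (x k) S\<close>. Its length is then at most
  \<open>2 * C\<close> times the resulting decrease of this distance, so that \<open>dist a (x k) + 2 * C * infdist (x k) S\<close>
  does not increase. This keeps the iterates in the ball, and by telescoping bounds the remaining
  path length by \<open>2 * C * infdist (x k) S\<close>. Since the distance of \<open>x k\<close> to \<open>S\<close> is at most its distance
  to the limit, the order of decrease of the former passes to the latter.
\<close>

lemma local_convergence: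
  fixes S :: "'a::complete_space set"
  assumes a: "a \<in> S" and S: "closed S" and "C > 0" "s > 1" "R > 0"
  shows "\<exists>r>0. \<forall>x. x 0 \<in> cball a r \<and>
           (\<forall>k. x k \<in> cball a R \<longrightarrow> dist (x (Suc k)) (x k) \<le> C * infdist (x k) S) \<and>
           (\<forall>k. x k \<in> cball a R \<longrightarrow> x (Suc k) \<in> cball a R \<longrightarrow>
              infdist (x (Suc k)) S \<le> C * infdist (x k) S powr s) \<longrightarrow>
           (\<exists>l\<in>S. x \<longlonglongrightarrow> l \<and>
              (\<forall>k. dist (x (Suc k)) l \<le> 2 * C\<^sup>2 * dist (x k) l powr s))"
proof -
  \<comment> \<open>On the ball of radius \<open>R'\<close> one has \<open>C * infdist y S powr (s - 1) \<le> 1 / 2\<close>.\<close>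
  define R' where "R' = min R ((1 / (2 * C)) powr (1 / (s - 1)))"
  define r where "r = R' / (1 + 2 * C)"
  have R': "R' > 0" "R' \<le> R" using assms by (auto simp: R'_def)
  have "R' powr (s - 1) \<le> ((1 / (2 * C)) powr (1 / (s - 1))) powr (s - 1)"
    using R' \<open>s > 1\<close> by (intro powr_mono2) (auto simp: R'_def)
  then have CR': "C * R' powr (s - 1) \<le> 1 / 2"
    using assms by (simp add: powr_powr field_simps)
  have r: "r > 0" "(1 + 2 * C) * r = R'" using R' \<open>C > 0\<close> by (auto simp: r_def add_pos_pos)
  have "\<exists>l\<in>S. x \<longlonglongrightarrow> l \<and> (\<forall>k. dist (x (Suc k)) l \<le> 2 * C\<^sup>2 * dist (x k) l powr s)"
    if x0: "x 0 \<in> cball a r"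
      and step: "\<And>k. x k \<in> cball a R \<Longrightarrow> dist (x (Suc k)) (x k) \<le> C * infdist (x k) S"
      and contr: "\<And>k. x k \<in> cball a R \<Longrightarrow> x (Suc k) \<in> cball a R \<Longrightarrow>
              infdist (x (Suc k)) S \<le> C * infdist (x k) S powr s"
    for x
  proof -
    define \<delta> where "\<delta> k = infdist (x k) S" for k
    have \<delta>0: "0 \<le> \<delta> k" for k by (simp add: \<delta>_def infdist_nonneg)
    have \<delta>a: "\<delta> k \<le> dist a (x k)" for k
      using infdist_le[OF a, of "x k"] by (simp add: \<delta>_def dist_commute)
    have next_step: "x k \<in> cball a R" "x (Suc k) \<in> cball a R"
        "dist (x (Suc k)) (x k) \<le> C * \<delta> k" "\<delta> (Suc k) \<le> \<delta> k / 2"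
        "dist a (x (Suc k)) + 2 * C * \<delta> (Suc k) \<le> R'"
      if inv: "dist a (x k) + 2 * C * \<delta> k \<le> R'" for k
    proof -
      have C\<delta>: "0 \<le> C * \<delta> k" using \<delta>0 \<open>C > 0\<close> by simp
      show xk: "x k \<in> cball a R" using inv C\<delta> R' by simp
      show st: "dist (x (Suc k)) (x k) \<le> C * \<delta> k" using step[OF xk] by (simp add: \<delta>_def)
      have tri: "dist a (x (Suc k)) \<le> dist a (x k) + C * \<delta> k"
        using st dist_triangle[of a "x (Suc k)" "x k"] by (simp add: dist_commute)
      show xk1: "x (Suc k) \<in> cball a R" using inv tri C\<delta> R' by simp
      have "\<delta> (Suc k) \<le> C * \<delta> k powr s" using contr[OF xk xk1] by (simp add: \<delta>_def)
      also have "\<delta> k powr s = \<delta> k powr (s - 1) * \<delta> k"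
        using \<delta>0[of k] by (cases "\<delta> k = 0") (auto simp: powr_diff)
      also have "C * \<dots> = (C * \<delta> k powr (s - 1)) * \<delta> k" by simp
      also have "\<dots> \<le> 1 / 2 * \<delta> k"
      proof (intro mult_right_mono)
        have "\<delta> k powr (s - 1) \<le> R' powr (s - 1)"
          using \<delta>a[of k] inv C\<delta> \<delta>0 \<open>s > 1\<close> by (intro powr_mono2) auto
        then show "C * \<delta> k powr (s - 1) \<le> 1 / 2"
          using CR' \<open>C > 0\<close> by (meson mult_left_mono order_trans less_imp_le)
      qed (rule \<delta>0)
      finally show half: "\<delta> (Suc k) \<le> \<delta> k / 2" by simp
      have "2 * C * \<delta> (Suc k) \<le> C * \<delta> k" using half \<open>C > 0\<close> by simp
      then show "dist a (x (Suc k)) + 2 * C * \<delta> (Suc k) \<le> R'" using tri inv by simp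
    qed
    have inv: "dist a (x k) + 2 * C * \<delta> k \<le> R'" for k
    proof (induction k)
      case 0
      have "dist a (x 0) \<le> r" using x0 by simp
      moreover have "2 * C * \<delta> 0 \<le> 2 * C * r" using \<delta>a[of 0] x0 \<open>C > 0\<close> by simp
      ultimately show ?case using r(2) by (simp add: algebra_simps)
    qed (rule next_step(5))
    note next_step = next_step[OF inv]
    have geom: "\<delta> k \<le> \<delta> 0 * (1 / 2) ^ k" for k
    proof (induction k)
      case (Suc k)
      then show ?case using next_step(4)[of k] by simp
    qed simp
    have \<delta>_lim: "\<delta> \<longlonglongrightarrow> 0"
    proof (rule tendsto_sandwich[of "\<lambda>_. 0"])
      show "(\<lambda>k. \<delta> 0 * (1 / 2) ^ k) \<longlonglongrightarrow> 0"
        by (intro tendsto_mult_right_zero LIMSEQ_power_zero) auto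
    qed (auto simp: \<delta>0 geom)
    have tail: "dist (x k) (x (k + j)) \<le> 2 * C * (\<delta> k - \<delta> (k + j))" for k j
    proof (induction j)
      case (Suc j)
      have "dist (x (k + j)) (x (Suc (k + j))) \<le> C * \<delta> (k + j)"
        using next_step(3)[of "k + j"] by (simp add: dist_commute)
      also have "\<dots> \<le> C * (2 * (\<delta> (k + j) - \<delta> (Suc (k + j))))"
        using next_step(4)[of "k + j"] \<open>C > 0\<close> by (intro mult_left_mono) auto
      finally show ?case
        using Suc dist_triangle[of "x k" "x (Suc (k + j))" "x (k + j)"]
        by (simp add: algebra_simps)
    qed simp
    have tail': "dist (x k) (x (k + j)) \<le> 2 * C * \<delta> k" for k j
    proof -
      have "2 * C * (\<delta> k - \<delta> (k + j)) \<le> 2 * C * \<delta> k" using \<delta>0 \<open>C > 0\<close> by simp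
      then show ?thesis using tail order_trans by blast
    qed
    have "Cauchy x"
      unfolding Cauchy_altdef
    proof (intro allI impI)
      fix e :: real assume "e > 0"
      then have "e / (2 * C) > 0" using \<open>C > 0\<close> by simp
      then obtain N where N: "\<And>k. k \<ge> N \<Longrightarrow> \<delta> k < e / (2 * C)"
        using order_tendstoD(2)[OF \<delta>_lim] unfolding eventually_sequentially by blast
      have "dist (x m) (x n) < e" if "m \<ge> N" "n > m" for m n
      proof -
        have "dist (x m) (x n) \<le> 2 * C * \<delta> m" using tail'[of m "n - m"] that by simp
        also have "\<dots> < e" using N[of m] that \<open>C > 0\<close> by (simp add: field_simps)
        finally show ?thesis .
      qed
      then show "\<exists>M. \<forall>m\<ge>M. \<forall>n>m. dist (x m) (x n) < e" by blast
    qed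
    then obtain l where l: "x \<longlonglongrightarrow> l" using Cauchy_convergent convergent_def by blast
    have "(\<lambda>k. infdist (x k) S) \<longlonglongrightarrow> infdist l S" by (rule tendsto_infdist[OF l])
    then have "infdist l S = 0" using \<delta>_lim LIMSEQ_unique unfolding \<delta>_def by blast
    then have lS: "l \<in> S" using in_closed_iff_infdist_zero[OF S] a by blast
    have to_l: "dist (x k) l \<le> 2 * C * \<delta> k" for k
    proof (rule tendsto_upperbound[OF tendsto_dist[OF tendsto_const]])
      show "(\<lambda>j. x (j + k)) \<longlonglongrightarrow> l" using l by (rule LIMSEQ_ignore_initial_segment)
      show "\<forall>\<^sub>F j in sequentially. dist (x k) (x (j + k)) \<le> 2 * C * \<delta> k"
        using tail'[of k] by (simp add: add.commute)
    qed simp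
    have "dist (x (Suc k)) l \<le> 2 * C\<^sup>2 * dist (x k) l powr s" for k
    proof -
      have "dist (x (Suc k)) l \<le> 2 * C * \<delta> (Suc k)" by (rule to_l)
      also have "\<dots> \<le> 2 * C * (C * \<delta> k powr s)"
        using contr[OF next_step(1,2)] \<open>C > 0\<close> by (simp add: \<delta>_def)
      also have "\<dots> \<le> 2 * C * (C * dist (x k) l powr s)"
        using infdist_le[OF lS, of "x k"] \<delta>0[of k] assms
        by (intro mult_left_mono powr_mono2) (auto simp: \<delta>_def)
      finally show ?thesis by (simp add: power2_eq_square mult_ac)
    qed
    with l lS show ?thesis by blast
  qed
  then show ?thesis using r(1) by blast
qed

lemma converges_superlinearly_of_order:
  assumes lim: "x \<longlonglongrightarrow> l" and s: "s > 1"
    and order: "\<And>k. dist (x (Suc k)) l \<le> K * dist (x k) l powr s"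
  shows "converges_superlinearly x l"
proof -
  have le: "norm (x (Suc k) - l) / norm (x k - l) \<le> K * dist (x k) l powr (s - 1)" for k
  proof (cases "x k = l")
    case False
    then have "dist (x k) l powr s = dist (x k) l powr (s - 1) * dist (x k) l"
      by (simp add: powr_diff)
    then show ?thesis using order[of k] False by (simp add: dist_norm field_simps)
  qed simp
  have "(\<lambda>k. dist (x k) l) \<longlonglongrightarrow> 0" using lim by (rule tendsto_dist_iff[THEN iffD1])
  then have "(\<lambda>k. dist (x k) l powr (s - 1)) \<longlonglongrightarrow> 0 powr (s - 1)"
    using s by (intro tendsto_powr2 tendsto_const) auto
  then have "(\<lambda>k. K * dist (x k) l powr (s - 1)) \<longlonglongrightarrow> 0"
    by (intro tendsto_mult_right_zero) simp
  then have "(\<lambda>k. norm (x (Suc k) - l) / norm (x k - l)) \<longlonglongrightarrow> 0"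
    by (rule tendsto_sandwich[OF _ _ tendsto_const, rotated 2]) (auto simp: le)
  with lim show ?thesis by (simp add: converges_superlinearly_def)
qed

section \<open>Auxiliary facts and the convergence theorem\<close>

lemma closed_global_minimizers:
  fixes f :: "'a::topological_space \<Rightarrow> real"
  assumes "continuous_on UNIV f"
  shows "closed (global_minimizers f)"
proof -
  have "global_minimizers f = (\<Inter>y. {x. f x \<le> f y})"
    by (auto simp: global_minimizers_def)
  also have "closed \<dots>"
    using assms by (intro closed_INT ballI closed_Collect_le continuous_on_const) auto
  finally show ?thesis .
qed

lemma GDERIV_global_minimizer:
  assumes "GDERIV f x :> g" "x \<in> global_minimizers f"
  shows "g = 0"
proof -
  have "(\<lambda>h. h \<bullet> g) = (\<lambda>h. 0)"
    using assms unfolding gderiv_def global_minimizers_def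
    by (intro has_derivative_local_min[of f _ x]) auto
  then have "g \<bullet> g = 0" by meson
  then show ?thesis by simp
qed

lemma matrix_mult_bounded_on_compact:
  fixes A :: "'a::topological_space \<Rightarrow> real ^ 'n ^ 'm"
  assumes "continuous_on S A" "compact S"
  obtains N where "\<And>x h. x \<in> S \<Longrightarrow> norm (A x *v h) \<le> N * norm h"
proof -
  have "bounded (A ` S)" using assms by (intro compact_imp_bounded compact_continuous_image)
  then obtain B where B: "\<And>x. x \<in> S \<Longrightarrow> norm (A x) \<le> B" by (auto simp: bounded_iff)
  have "norm (A x *v h) \<le> real CARD('m) * real CARD('n) * B * norm h" if "x \<in> S" for x h
  proof -
    have "onorm ((*v) (A x)) \<le> real CARD('m) * real CARD('n) * B"
    proof (rule onorm_le_matrix_component)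
      fix i j
      have "\<bar>A x $ i $ j\<bar> \<le> norm (A x $ i)" by (rule component_le_norm_cart)
      also have "\<dots> \<le> norm (A x)" by (rule Finite_Cartesian_Product.norm_nth_le)
      finally show "\<bar>A x $ i $ j\<bar> \<le> B" using B[OF that] by simp
    qed
    then show ?thesis
      using onorm[OF matrix_vector_mul_bounded_linear[of "A x"], of h]
      by (meson mult_right_mono norm_ge_zero order_trans)
  qed
  then show ?thesis using that by blast
qed


theorem theorem2:
  fixes f :: "real ^ 'n \<Rightarrow> real"
    and grad :: "real ^ 'n \<Rightarrow> real ^ 'n"
    and hess :: "real ^ 'n \<Rightarrow> real ^ 'n ^ 'n"
    and xstar :: "real ^ 'n"
    and p L c1 c2 q :: real
  assumes convex: "convex_on UNIV f"
    and grad: "\<And>x. GDERIV f x :> grad x"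
    and hess: "\<And>x. (grad has_derivative (\<lambda>h. hess x *v h)) (at x)"
    and hess_cont: "continuous_on UNIV hess"
    and xstar: "xstar \<in> global_minimizers f"
    and p: "1 < p" "p \<le> 3"
    and L: "L > 0"
    and c1: "c1 \<ge> L"
    and c2: "0 < c2" "c2 < 1"
    and q: "q \<ge> 0"
    and A1_grad: "\<And>x y. norm (grad x - grad y - hess y *v (x - y)) \<le> L * (norm (x - y))\<^sup>2"
    and A1_fun: "\<And>x y. \<bar>f x - f y - grad y \<bullet> (x - y) - 1/2 * ((hess y *v (x - y)) \<bullet> (x - y))\<bar>
                   \<le> L / 3 * norm (x - y) ^ 3"
    and A7: "\<exists>r1>0. \<exists>m1>0. \<forall>x\<in>cball xstar r1.
               infdist x (global_minimizers f) \<le> m1 * norm (grad x)"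
  shows "\<exists>r>0. \<forall>x0\<in>cball xstar r. \<forall>x :: nat \<Rightarrow> real ^ 'n.
           grnm_sequence grad hess p
             (\<lambda>k. c1 powr ((p - 1) / 2) * norm (grad (x k)) powr ((3 - p) / 2))
             (\<lambda>k. min (q / sqrt (real CARD('n)) * norm (grad (x k)))
                      (c2 * norm (grad (x k)) powr ((p + 1) / 2)))
             x0 x \<and>
           (\<forall>k. grad (x k) \<noteq> 0) \<longrightarrow>
           (\<exists>xbar\<in>global_minimizers f.
              converges_superlinearly x xbar \<and>
              (p = 3 \<longrightarrow> converges_quadratically x xbar))"
proof -
  define S where "S = global_minimizers f"
  have sym: "(hess x *v u) \<bullet> v = (hess x *v v) \<bullet> u" for x u v
    by (rule second_derivative_symmetric[OF grad hess])
  have psd: "0 \<le> (hess x *v u) \<bullet> u" for x u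
  proof (rule convex_second_order_nonneg[OF convex matrix_vector_mul_linear])
    show "\<bar>f (x + h) - f x - grad x \<bullet> h - 1/2 * ((hess x *v h) \<bullet> h)\<bar> \<le> L / 3 * norm h ^ 3" for h
      using A1_fun[of "x + h" x] by simp
  qed
  have "continuous_on UNIV f"
    using grad by (auto simp: gderiv_def intro!: continuous_at_imp_continuous_on has_derivative_continuous)
  then have S_closed: "closed S" unfolding S_def by (rule closed_global_minimizers)
  have S_ne: "xstar \<in> S" "S \<noteq> {}" using xstar by (auto simp: S_def)
  have grad_S: "grad y = 0" if "y \<in> S" for y
    using GDERIV_global_minimizer[OF grad] that by (simp add: S_def)
  obtain r1 m where r1: "r1 > 0" and m: "m > 0"
    and err: "\<And>x. x \<in> cball xstar r1 \<Longrightarrow> infdist x S \<le> m * norm (grad x)"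
    using A7 unfolding S_def by blast
  \<comment> \<open>Radius at most 1, so that higher powers of the distance are smaller than lower ones.\<close>
  define R where "R = min r1 1"
  have R: "R > 0" "R \<le> r1" "R \<le> 1" using r1 by (auto simp: R_def)
  obtain N where N: "\<And>x h. x \<in> cball xstar R \<Longrightarrow> norm (hess x *v h) \<le> N * norm h"
    using matrix_mult_bounded_on_compact[OF continuous_on_subset[OF hess_cont subset_UNIV] compact_cball]
    by metis
  define M where "M = \<bar>N\<bar> + L"
  have const_pos: "c1 > 0" "c2 \<ge> 0" "M \<ge> 0" "L \<ge> 0" using c1 c2 L by (auto simp: M_def)
  obtain C where C: "C > 0" and est:
    "\<And>(g :: real ^ 'n) H e d \<rho>.
      \<lbrakk>is_arg_min (grnm_model p (c1 powr ((p - 1) / 2) * norm g powr ((3 - p) / 2)) \<rho> g H) (\<lambda>_. True) d;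
       0 \<le> \<rho>; \<rho> \<le> c2 * norm g powr ((p + 1) / 2);
       \<And>u v. (H *v u) \<bullet> v = (H *v v) \<bullet> u; \<And>u. 0 \<le> (H *v u) \<bullet> u;
       e \<noteq> 0; norm e \<le> 1; norm e \<le> m * norm g; norm g \<le> M * norm e;
       norm (g + H *v e) \<le> L * (norm e)\<^sup>2\<rbrakk>
      \<Longrightarrow> norm d \<le> C * norm e \<and> norm (g + H *v d) \<le> C * norm e powr ((p + 1) / 2)"
    by (rule grnm_step_estimates[OF p const_pos(1,2) m const_pos(3,4)]) blast
  define s where "s = (p + 1) / 2"
  have s: "1 < s" "s \<le> 2" using p by (auto simp: s_def)
  define K where "K = max C (m * (C + L * C\<^sup>2))"
  have K: "K > 0" "C \<le> K" "m * (C + L * C\<^sup>2) \<le> K" using C by (auto simp: K_def)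
  obtain r where r: "r > 0" and conv: "\<And>x. \<lbrakk>x 0 \<in> cball xstar r;
      \<And>k. x k \<in> cball xstar R \<Longrightarrow> dist (x (Suc k)) (x k) \<le> K * infdist (x k) S;
      \<And>k. x k \<in> cball xstar R \<Longrightarrow> x (Suc k) \<in> cball xstar R \<Longrightarrow>
        infdist (x (Suc k)) S \<le> K * infdist (x k) S powr s\<rbrakk>
      \<Longrightarrow> \<exists>l\<in>S. x \<longlonglongrightarrow> l \<and> (\<forall>k. dist (x (Suc k)) l \<le> 2 * K\<^sup>2 * dist (x k) l powr s)"
    using local_convergence[OF S_ne(1) S_closed K(1) s(1) R(1)] by blast
  have "\<exists>l\<in>S. converges_superlinearly x l \<and> (p = 3 \<longrightarrow> converges_quadratically x l)"
    if x0: "x0 \<in> cball xstar r" and nz: "\<And>k. grad (x k) \<noteq> 0"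
      and seq: "grnm_sequence grad hess p
             (\<lambda>k. c1 powr ((p - 1) / 2) * norm (grad (x k)) powr ((3 - p) / 2))
             (\<lambda>k. min (q / sqrt (real CARD('n)) * norm (grad (x k)))
                      (c2 * norm (grad (x k)) powr ((p + 1) / 2))) x0 x"
    for x0 and x :: "nat \<Rightarrow> real ^ 'n"
  proof -
    have step: "dist (x (Suc k)) (x k) \<le> C * infdist (x k) S \<and>
        norm (grad (x (Suc k))) \<le> (C + L * C\<^sup>2) * infdist (x k) S powr s"
      if xk: "x k \<in> cball xstar R" for k
    proof -
      let ?g = "grad (x k)" and ?H = "hess (x k)"
      obtain y where y: "y \<in> S" "infdist (x k) S = dist (x k) y"
        using infdist_attains_inf[OF S_closed S_ne(2)] by blast
      define e where "e = y - x k"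
      have e: "norm e = infdist (x k) S" by (simp add: y(2) e_def dist_norm norm_minus_commute)
      have e1: "norm e \<le> 1"
        using infdist_le[OF S_ne(1), of "x k"] xk R(3) by (simp add: e dist_commute)
      have newton: "norm (?g + ?H *v e) \<le> L * (norm e)\<^sup>2"
        using A1_grad[of y "x k"] grad_S[OF y(1)] norm_minus_cancel[of "?g + ?H *v e"]
        by (simp add: e_def)
      have "norm ?g \<le> norm (?g + ?H *v e) + norm (?H *v e)"
        using norm_triangle_ineq4[of "?g + ?H *v e" "?H *v e"] by simp
      also have "\<dots> \<le> L * (norm e)\<^sup>2 + N * norm e" using newton N[OF xk] by (rule add_mono)
      also have "\<dots> \<le> L * norm e + \<bar>N\<bar> * norm e"
        using e1 L by (intro add_mono mult_left_mono mult_right_mono)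
          (auto simp: power2_eq_square mult_left_le)
      finally have gM: "norm ?g \<le> M * norm e" by (simp add: M_def algebra_simps)
      \<comment> \<open>An iterate in the solution set would have zero gradient.\<close>
      have "e \<noteq> 0" using gM nz[of k] by auto
      have gm: "norm e \<le> m * norm ?g" using err[of "x k"] xk R(2) by (simp add: e)
      obtain d where min: "is_arg_min (grnm_model p
          (c1 powr ((p - 1) / 2) * norm ?g powr ((3 - p) / 2))
          (min (q / sqrt (real CARD('n)) * norm ?g) (c2 * norm ?g powr ((p + 1) / 2))) ?g ?H) (\<lambda>_. True) d"
        and d: "x (Suc k) = x k + d"
        using seq unfolding grnm_sequence_def by blast
      have *: "norm d \<le> C * norm e \<and> norm (?g + ?H *v d) \<le> C * norm e powr s"
        unfolding s_def
        by (rule est[OF min _ _ sym psd \<open>e \<noteq> 0\<close> e1 gm gM newton]) (use q c2 in auto)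
      have "norm (grad (x (Suc k))) \<le> norm (?g + ?H *v d) + L * (norm d)\<^sup>2"
        using A1_grad[of "x (Suc k)" "x k"]
          norm_triangle_ineq[of "?g + ?H *v d" "grad (x (Suc k)) - ?g - ?H *v d"]
        by (simp add: d)
      also have "L * (norm d)\<^sup>2 \<le> L * (C * norm e)\<^sup>2"
        using * L by (intro mult_left_mono power_mono) auto
      also have "\<dots> \<le> L * C\<^sup>2 * norm e powr s"
        using powr_mono'[of s 2 "norm e"] s e1 L by (simp add: power_mult_distrib mult_left_mono)
      finally have "norm (grad (x (Suc k))) \<le> C * norm e powr s + L * C\<^sup>2 * norm e powr s"
        using * by simp
      with * show ?thesis by (simp add: d dist_norm e distrib_right)
    qed
    have "\<exists>l\<in>S. x \<longlonglongrightarrow> l \<and> (\<forall>k. dist (x (Suc k)) l \<le> 2 * K\<^sup>2 * dist (x k) l powr s)"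
    proof (rule conv)
      show "x 0 \<in> cball xstar r" using x0 seq by (simp add: grnm_sequence_def)
    next
      fix k assume "x k \<in> cball xstar R"
      with step[of k] show "dist (x (Suc k)) (x k) \<le> K * infdist (x k) S"
        using K(2) infdist_nonneg by (meson mult_right_mono order_trans)
    next
      fix k assume xk: "x k \<in> cball xstar R" and "x (Suc k) \<in> cball xstar R"
      then have "infdist (x (Suc k)) S \<le> m * norm (grad (x (Suc k)))"
        using err R(2) by simp
      also have "\<dots> \<le> m * ((C + L * C\<^sup>2) * infdist (x k) S powr s)"
        using step[OF xk] m by simp
      also have "\<dots> \<le> K * infdist (x k) S powr s"
        using K(3) unfolding mult.assoc[symmetric] by (rule mult_right_mono) simp
      finally show "infdist (x (Suc k)) S \<le> K * infdist (x k) S powr s" .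
    qed
    then obtain l where l: "l \<in> S" "x \<longlonglongrightarrow> l"
      and order: "\<And>k. dist (x (Suc k)) l \<le> 2 * K\<^sup>2 * dist (x k) l powr s" by blast
    have "converges_superlinearly x l"
      by (rule converges_superlinearly_of_order[OF l(2) s(1) order])
    moreover have "converges_quadratically x l" if "p = 3"
      unfolding converges_quadratically_def
    proof (intro conjI exI[of _ "2 * K\<^sup>2"] always_eventually allI)
      show "norm (x (Suc k) - l) \<le> 2 * K\<^sup>2 * (norm (x k - l))\<^sup>2" for k
        using order[of k] that by (simp add: s_def dist_norm)
    qed (use l K in auto)
    ultimately show ?thesis using l(1) by blast
  qed
  then show ?thesis using r unfolding S_def by blast
qed

end
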